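(* Let $\tilde G_1,\tilde G_2$ be linear time-invariant systems $$\tilde G_i:\quad \begin{pmatrix}\dot x_i\\ w_i\end{pmatrix}=\begin{pmatrix}A_i&B_i\\ C_i&D_i\end{pmatrix}\begin{pmatrix}x_i\\ v_i\end{pmatrix},\qquad i=1,2,$$ with $A_i\in\mathbb{R}^{n_i\times n_i}$, $D_i\in\mathbb{R}^{n_{wi}\times n_{vi}}$, $n_{v1}=n_{w2}$, $n_{v2}=n_{w1}$, and let $\tilde G$ be the autonomous system obtained by imposing $v_1=w_2$, $v_2=w_1$. Let $C_1$ and $C_2$ have full row rank. Suppose that $\tilde G$ is well-posed, stable and admits an additive quadratic Lyapunov function $V(x_1,x_2)=V_1(x_1)+V_2(x_2)$. Then there exist quadratic functions $s_{1,int}(v_1,w_1)$, $s_{2,int}(v_2,w_2)$ such that $$s_{1,int}(v_1,w_1)+s_{2,int}(v_2,w_2)=0\quad\text{whenever } v_1=w_2,\ v_2=w_1,$$ and (i) $\tilde G_1$ is strictly dissipative with respect to $s_{1,int}(v_1,w_1)$ with the storage function $V_1(x_1)$; (ii) $\tilde G_2$ is strictly dissipative with respect to $s_{2,int}(v_2,w_2)$ with the storage function $V_2(x_2)$.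
   Context: All matrices are real. "Quadratic function" means a quadratic form. "Stable" means asymptotically stable. The interconnection is well-posed if the constraints $v_1=w_2$, $v_2=w_1$ determine $v_1,v_2$ uniquely from $x_1,x_2$, i.e. $I-D_2D_1$ is invertible; then $\tilde G$ has the form $\dot x=\mathcal{A}x$ with $x=\mathrm{col}(x_1,x_2)$. An additive quadratic Lyapunov function for $\tilde G$ is $V(x_1,x_2)=V_1(x_1)+V_2(x_2)$ with $V_i(x_i)=x_i^\top P_ix_i$, $P_i$ symmetric positive definite, such that $\mathcal{A}^\top P+P\mathcal{A}\prec0$ for $P=\mathrm{diag}(P_1,P_2)$. A linear system $\dot x=Ax+Bv$, $w=Cx+Dv$ is strictly dissipative with respect to a quadratic supply function $s(v,w)$ (a quadratic form in $(v,w)$) with storage function $V(x)=x^\top Px$ if $2x^\top P(Ax+Bv)<s(v,\,Cx+Dv)$ for all $(x,v)\neq0$. *)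

theory Defs
  imports "HOL-Analysis.Analysis"
begin

definition stack :: "real^'a \<Rightarrow> real^'b \<Rightarrow> real^('a + 'b)" where
  "stack x y = (\<chi> i. case i of Inl a \<Rightarrow> x $ a | Inr b \<Rightarrow> y $ b)"

definition block_matrix ::
  "real^'c^'a \<Rightarrow> real^'d^'a \<Rightarrow> real^'c^'b \<Rightarrow> real^'d^'b \<Rightarrow> real^('c + 'd)^('a + 'b)" where
  "block_matrix M11 M12 M21 M22 =
     (\<chi> i. case i of Inl a \<Rightarrow> stack (M11 $ a) (M12 $ a) | Inr b \<Rightarrow> stack (M21 $ b) (M22 $ b))"

definition quad_form :: "real^'n^'n \<Rightarrow> real^'n \<Rightarrow> real" where
  "quad_form P x = x \<bullet> (P *v x)"

definition sym_matrix :: "real^'n^'n \<Rightarrow> bool" where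
  "sym_matrix P \<longleftrightarrow> transpose P = P"

definition sym_pos_def :: "real^'n^'n \<Rightarrow> bool" where
  "sym_pos_def P \<longleftrightarrow> sym_matrix P \<and> (\<forall>x. x \<noteq> 0 \<longrightarrow> quad_form P x > 0)"

definition sym_neg_def :: "real^'n^'n \<Rightarrow> bool" where
  "sym_neg_def P \<longleftrightarrow> sym_matrix P \<and> (\<forall>x. x \<noteq> 0 \<longrightarrow> quad_form P x < 0)"

definition quadratic_function :: "(real^'v \<Rightarrow> real^'w \<Rightarrow> real) \<Rightarrow> bool" where
  "quadratic_function s \<longleftrightarrow>
     (\<exists>S. sym_matrix S \<and> (\<forall>v w. s v w = quad_form S (stack v w)))"

text \<open>The derivative of \<open>V (x t) = x t \<bullet> (P *v x t)\<close> along the system is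
  \<open>2 * (x \<bullet> (P *v (A *v x + B *v v)))\<close> because \<open>P\<close> is symmetric; the symmetric \<open>P\<close>
  representing \<open>V\<close> is unique.\<close>

definition strictly_dissipative ::
  "real^'n^'n \<Rightarrow> real^'v^'n \<Rightarrow> real^'n^'w \<Rightarrow> real^'v^'w
     \<Rightarrow> (real^'v \<Rightarrow> real^'w \<Rightarrow> real) \<Rightarrow> (real^'n \<Rightarrow> real) \<Rightarrow> bool" where
  "strictly_dissipative A B C D s V \<longleftrightarrow>
     (\<exists>P. sym_matrix P \<and> V = quad_form P \<and>
        (\<forall>x v. (x, v) \<noteq> (0, 0) \<longrightarrow>
           2 * (x \<bullet> (P *v (A *v x + B *v v))) < s v (C *v x + D *v v)))"

text \<open>Substituting \<open>v\<^sub>1 = w\<^sub>2\<close> and \<open>v\<^sub>2 = w\<^sub>1\<close> into the output equations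
  \<open>w\<^sub>i = C\<^sub>i x\<^sub>i + D\<^sub>i v\<^sub>i\<close>.\<close>

definition interconnection ::
  "real^'n1^'m2 \<Rightarrow> real^'m1^'m2 \<Rightarrow> real^'n2^'m1 \<Rightarrow> real^'m2^'m1
     \<Rightarrow> real^'n1 \<Rightarrow> real^'n2 \<Rightarrow> real^'m1 \<Rightarrow> real^'m2 \<Rightarrow> bool" where
  "interconnection C1 D1 C2 D2 x1 x2 v1 v2 \<longleftrightarrow>
     v1 = C2 *v x2 + D2 *v v2 \<and> v2 = C1 *v x1 + D1 *v v1"

definition well_posed ::
  "real^'n1^'m2 \<Rightarrow> real^'m1^'m2 \<Rightarrow> real^'n2^'m1 \<Rightarrow> real^'m2^'m1 \<Rightarrow> bool" where
  "well_posed C1 D1 C2 D2 \<longleftrightarrow>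
     (\<forall>x1 x2. \<exists>!v. interconnection C1 D1 C2 D2 x1 x2 (fst v) (snd v))"

text \<open>The closed-loop matrix, obtained by eliminating
  \<open>v\<^sub>1 = (I - D\<^sub>2 D\<^sub>1)\<^sup>-\<^sup>1 (D\<^sub>2 C\<^sub>1 x\<^sub>1 + C\<^sub>2 x\<^sub>2)\<close> and \<open>v\<^sub>2 = C\<^sub>1 x\<^sub>1 + D\<^sub>1 v\<^sub>1\<close>
  (see \<open>closed_loop_eq\<close> below).
  It is meaningful only for well-posed interconnections.\<close>

definition closed_loop ::
  "real^'n1^'n1 \<Rightarrow> real^'m1^'n1 \<Rightarrow> real^'n1^'m2 \<Rightarrow> real^'m1^'m2
     \<Rightarrow> real^'n2^'n2 \<Rightarrow> real^'m2^'n2 \<Rightarrow> real^'n2^'m1 \<Rightarrow> real^'m2^'m1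
     \<Rightarrow> real^('n1 + 'n2)^('n1 + 'n2)" where
  "closed_loop A1 B1 C1 D1 A2 B2 C2 D2 =
     (let E = matrix_inv (mat 1 - D2 ** D1)
      in block_matrix
           (A1 + B1 ** E ** D2 ** C1)              (B1 ** E ** C2)
           (B2 ** (C1 + D1 ** E ** D2 ** C1))      (A2 + B2 ** D1 ** E ** C2))"

definition trajectory :: "real^'n^'n \<Rightarrow> (real \<Rightarrow> real^'n) \<Rightarrow> bool" where
  "trajectory A x \<longleftrightarrow> (\<forall>t\<ge>0. (x has_vector_derivative A *v x t) (at t within {0..}))"

definition asymptotically_stable :: "real^'n^'n \<Rightarrow> bool" where
  "asymptotically_stable A \<longleftrightarrow>
     (\<forall>\<epsilon>>0. \<exists>\<delta>>0. \<forall>x. trajectory A x \<and> norm (x 0) < \<delta> \<longrightarrow> (\<forall>t\<ge>0. norm (x t) < \<epsilon>)) \<and>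
     (\<exists>\<delta>>0. \<forall>x. trajectory A x \<and> norm (x 0) < \<delta> \<longrightarrow> (x \<longlongrightarrow> 0) at_top)"

definition additive_quadratic_lyapunov ::
  "real^('n1 + 'n2)^('n1 + 'n2) \<Rightarrow> (real^'n1 \<Rightarrow> real^'n2 \<Rightarrow> real)
     \<Rightarrow> (real^'n1 \<Rightarrow> real) \<Rightarrow> (real^'n2 \<Rightarrow> real) \<Rightarrow> bool" where
  "additive_quadratic_lyapunov A V V1 V2 \<longleftrightarrow>
     (\<forall>x1 x2. V x1 x2 = V1 x1 + V2 x2) \<and>
     (\<exists>P1 P2. sym_pos_def P1 \<and> sym_pos_def P2 \<and> V1 = quad_form P1 \<and> V2 = quad_form P2 \<and>
        (let P = block_matrix P1 0 0 P2
         in sym_neg_def (transpose A ** P + P ** A)))"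

lemma block_matrix_vector_mult:
  "block_matrix M11 M12 M21 M22 *v stack x y = stack (M11 *v x + M12 *v y) (M21 *v x + M22 *v y)"
proof -
  have "sum f UNIV = (\<Sum>a\<in>UNIV. f (Inl a)) + (\<Sum>b\<in>UNIV. f (Inr b))"
    for f :: "'c::finite + 'd::finite \<Rightarrow> real"
    by (subst UNIV_Plus_UNIV[symmetric], subst sum.Plus) auto
  then show ?thesis
    by (auto simp: vec_eq_iff block_matrix_def stack_def matrix_vector_mult_def
        split: sum.splits)
qed

lemma matrix_inv_left_right:
  fixes M :: "real^'n^'n"
  assumes "invertible M"
  shows "matrix_inv M ** M = mat 1" "M ** matrix_inv M = mat 1"
  using someI_ex[OF assms[unfolded invertible_def]] unfolding matrix_inv_def by auto

lemma well_posed_iff: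
  "well_posed C1 D1 C2 D2 \<longleftrightarrow> invertible (mat 1 - D2 ** D1)"
proof
  assume wp: "well_posed C1 D1 C2 D2"
  have "v = 0" if "(mat 1 - D2 ** D1) *v v = 0" for v
  proof -
    have *: "v = D2 *v (D1 *v v)"
      using that by (simp add: matrix_vector_mult_diff_rdistrib matrix_vector_mul_assoc)
    have "interconnection C1 D1 C2 D2 0 0 (fst (v, D1 *v v)) (snd (v, D1 *v v))"
      using * by (simp add: interconnection_def)
    moreover have "interconnection C1 D1 C2 D2 0 0 (fst (0, 0)) (snd (0, 0))"
      by (simp add: interconnection_def)
    ultimately have "(v, D1 *v v) = (0, 0)"
      using wp unfolding well_posed_def by blast
    then show ?thesis by simp
  qed
  then show "invertible (mat 1 - D2 ** D1)"
    by (simp add: invertible_left_inverse matrix_left_invertible_ker)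
next
  assume inv: "invertible (mat 1 - D2 ** D1)"
  let ?M = "mat 1 - D2 ** D1"
  let ?E = "matrix_inv ?M"
  have E: "?E ** ?M = mat 1" "?M ** ?E = mat 1"
    using matrix_inv_left_right[OF inv] by auto
  show "well_posed C1 D1 C2 D2"
    unfolding well_posed_def
  proof (intro allI)
    fix x1 x2
    define b where "b = D2 *v (C1 *v x1) + C2 *v x2"
    have iff: "interconnection C1 D1 C2 D2 x1 x2 v1 v2 \<longleftrightarrow>
        v1 = ?E *v b \<and> v2 = C1 *v x1 + D1 *v v1" for v1 v2
    proof -
      have M: "?M *v v1 = v1 - D2 *v (D1 *v v1)"
        by (simp only: matrix_vector_mult_diff_rdistrib matrix_vector_mul_lid
            matrix_vector_mul_assoc[symmetric])
      have "v1 = C2 *v x2 + D2 *v (C1 *v x1 + D1 *v v1) \<longleftrightarrow> ?M *v v1 = b"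
        unfolding M b_def matrix_vector_right_distrib by (auto simp only: diff_eq_eq add_ac)
      then have "interconnection C1 D1 C2 D2 x1 x2 v1 v2 \<longleftrightarrow>
          ?M *v v1 = b \<and> v2 = C1 *v x1 + D1 *v v1"
        unfolding interconnection_def by auto
      also have "?M *v v1 = b \<longleftrightarrow> v1 = ?E *v b"
      proof
        assume "?M *v v1 = b"
        then have "?E *v b = (?E ** ?M) *v v1"
          by (simp only: matrix_vector_mul_assoc[symmetric])
        then show "v1 = ?E *v b" by (simp only: E matrix_vector_mul_lid)
      next
        assume "v1 = ?E *v b"
        then have "?M *v v1 = (?M ** ?E) *v b"
          by (simp only: matrix_vector_mul_assoc)
        then show "?M *v v1 = b" by (simp only: E matrix_vector_mul_lid)
      qed
      finally show ?thesis .
    qed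
    show "\<exists>!v. interconnection C1 D1 C2 D2 x1 x2 (fst v) (snd v)"
      by (rule ex1I[of _ "(?E *v b, C1 *v x1 + D1 *v (?E *v b))"])
         (auto simp: iff prod_eq_iff)
  qed
qed

lemma closed_loop_eq:
  assumes wp: "well_posed C1 D1 C2 D2"
    and ic: "interconnection C1 D1 C2 D2 x1 x2 v1 v2"
  shows "closed_loop A1 B1 C1 D1 A2 B2 C2 D2 *v stack x1 x2 =
           stack (A1 *v x1 + B1 *v v1) (A2 *v x2 + B2 *v v2)"
proof -
  let ?M = "mat 1 - D2 ** D1"
  have E: "matrix_inv ?M ** ?M = mat 1"
    using matrix_inv_left_right(1) wp well_posed_iff by blast
  have v2: "v2 = C1 *v x1 + D1 *v v1"
    using ic unfolding interconnection_def by blast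
  have M: "?M *v v1 = v1 - D2 *v (D1 *v v1)"
    by (simp only: matrix_vector_mult_diff_rdistrib matrix_vector_mul_lid
        matrix_vector_mul_assoc[symmetric])
  have "v1 = C2 *v x2 + D2 *v v2"
    using ic unfolding interconnection_def by blast
  then have "?M *v v1 = D2 *v (C1 *v x1) + C2 *v x2"
    unfolding M v2 matrix_vector_right_distrib by (simp only: diff_eq_eq add_ac)
  then have "(matrix_inv ?M ** ?M) *v v1 = matrix_inv ?M *v (D2 *v (C1 *v x1) + C2 *v x2)"
    by (simp only: matrix_vector_mul_assoc[symmetric])
  then have v1: "v1 = matrix_inv ?M *v (D2 *v (C1 *v x1) + C2 *v x2)"
    by (simp only: E matrix_vector_mul_lid)
  show ?thesis
    unfolding closed_loop_def Let_def block_matrix_vector_mult v2 v1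
    by (simp only: matrix_vector_mult_add_rdistrib matrix_vector_mul_assoc[symmetric]
        matrix_vector_right_distrib add_ac)
qed

end

theory Submission imports Defs begin

text \<open>
  Let \<open>T\<^sub>i\<close> map state and input of the \<open>i\<close>-th system to the interconnection
  signals \<open>z = (v\<^sub>1, w\<^sub>1) = (w\<^sub>2, v\<^sub>2)\<close>, and let \<open>q\<^sub>i\<close> be the derivative of \<open>V\<^sub>i\<close>, a quadratic form in
  state and input. The Lyapunov condition reads \<open>q\<^sub>1 \<xi>\<^sub>1 + q\<^sub>2 \<xi>\<^sub>2 < 0\<close> whenever \<open>T\<^sub>1 \<xi>\<^sub>1 = T\<^sub>2 \<xi>\<^sub>2\<close>
  and \<open>(\<xi>\<^sub>1, \<xi>\<^sub>2) \<noteq> 0\<close>. In particular \<open>q\<^sub>i\<close> is negative definite on the kernel of \<open>T\<^sub>i\<close>. The full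
  row rank of \<open>C\<^sub>i\<close> makes \<open>T\<^sub>i\<close> surjective, so the maximum \<open>\<sigma>\<^sub>i z\<close> of \<open>q\<^sub>i\<close> over the fibre of \<open>T\<^sub>i\<close>
  above \<open>z\<close> exists, and it is a quadratic form in \<open>z\<close> because the maximizer depends linearly on
  \<open>z\<close>. As \<open>\<sigma>\<^sub>1 + \<sigma>\<^sub>2\<close> is negative definite, \<open>s = (\<sigma>\<^sub>1 - \<sigma>\<^sub>2) / 2\<close> lies strictly between \<open>\<sigma>\<^sub>1\<close> and
  \<open>- \<sigma>\<^sub>2\<close>, and the supply functions are \<open>s\<close> and \<open>- s\<close>.
\<close>

section \<open>Quadratic forms on the fibres of a surjective linear map\<close>

text \<open>The kernel is the orthogonal complement of the range of \<open>adjoint T\<close>, and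
  surjectivity of \<open>T\<close> makes \<open>adjoint T\<close> injective.\<close>

lemma dim_kernel_surj:
  fixes T :: "'a::euclidean_space \<Rightarrow> 'b::euclidean_space"
  assumes T: "linear T" and surj: "surj T"
  shows "dim {x. T x = 0} + DIM('b) = DIM('a)"
proof -
  have adj: "linear (adjoint T)"
    using T by (rule adjoint_linear)
  have "z = 0" if "adjoint T z = 0" for z
  proof -
    obtain x where "z = T x"
      using surj by (meson surj_def)
    then have "z \<bullet> z = adjoint T z \<bullet> x"
      by (simp add: adjoint_clauses[OF T])
    then show ?thesis using that by simp
  qed
  then have "inj (adjoint T)"
    using linear_inj_iff_eq_0[OF adj] by blast
  then have "dim (range (adjoint T)) = DIM('b)"
    using dim_image_eq[OF adj, of UNIV] by simp
  moreover have "{x. T x = 0} = {y \<in> UNIV. \<forall>x\<in>range (adjoint T). orthogonal x y}"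
    by (auto simp: orthogonal_def adjoint_clauses[OF T]) (metis inner_eq_zero_iff)
  ultimately show ?thesis
    using dim_subspace_orthogonal_to_vectors[OF linear_subspace_image[OF adj subspace_UNIV] subspace_UNIV]
    by simp
qed

text \<open>A maximizer on a fibre is a point orthogonal to the kernel \<open>K\<close> with respect
  to the symmetric bilinear form of \<open>x \<bullet> g x\<close>. These points form the subspace
  \<open>W\<close>; a dimension count shows that \<open>T\<close> maps \<open>W\<close> bijectively
  onto its codomain, and \<open>L\<close> is the inverse.\<close>

lemma linear_fiberwise_maximizer:
  fixes T :: "'a::euclidean_space \<Rightarrow> 'b::euclidean_space" and g :: "'a \<Rightarrow> 'a"
  assumes T: "linear T" and surj: "surj T" and g: "linear g"
    and neg: "\<And>x. T x = 0 \<Longrightarrow> x \<noteq> 0 \<Longrightarrow> x \<bullet> g x < 0"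
  obtains L where "linear L" "\<And>z. T (L z) = z"
    "\<And>x. x \<bullet> g x \<le> L (T x) \<bullet> g (L (T x))"
proof -
  \<comment> \<open>As \<open>g\<close> need not be self-adjoint, it is symmetrized:
    \<open>f x \<bullet> y\<close> is twice the polar form of
    \<open>x \<bullet> g x\<close>.\<close>
  define f where "f x = g x + adjoint g x" for x
  define K where "K = {x. T x = 0}"
  define W where "W = {y. \<forall>k\<in>K. f k \<bullet> y = 0}"
  have f: "linear f"
    unfolding f_def using g adjoint_linear[OF g] by (intro linear_compose_add) auto
  have fxy: "f x \<bullet> y = g x \<bullet> y + x \<bullet> g y" for x y
    by (simp add: f_def inner_left_distrib adjoint_clauses[OF g])
  have K: "subspace K"
    unfolding K_def using T by (rule linear_subspace_kernel)
  have W: "subspace W"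
    unfolding W_def by (auto simp: subspace_def inner_right_distrib)
  have fK: "subspace (f ` K)"
    using f K by (rule linear_subspace_image)
  have "W = {y \<in> UNIV. \<forall>x\<in>f ` K. orthogonal x y}"
    by (auto simp: W_def orthogonal_def)
  then have "dim W + dim (f ` K) = DIM('a)"
    using dim_subspace_orthogonal_to_vectors[OF fK subspace_UNIV] by simp
  moreover have "dim (f ` K) \<le> dim K"
    using f by (rule dim_image_le)
  moreover have "dim K + DIM('b) = DIM('a)"
    using dim_kernel_surj[OF T surj] by (simp add: K_def)
  ultimately have dimW: "dim W \<ge> DIM('b)"
    by linarith
  \<comment> \<open>On \<open>W \<inter> K\<close> the form vanishes, since
    \<open>f x \<bullet> x = 2 * (x \<bullet> g x)\<close>, yet it is negative definite on
    \<open>K\<close>.\<close>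
  have "x = 0" if "x \<in> W" "x \<in> K" for x
    using that fxy[of x x] neg[of x] by (force simp: W_def K_def inner_commute)
  then have "inj_on T W"
    using linear_inj_on_iff_eq_0[OF T W] by (auto simp: K_def)
  then have "dim (T ` W) = dim W"
    using dim_image_eq[OF T] W by (metis span_eq_iff)
  then have "T ` W = UNIV"
    using dimW dim_eq_full[of "T ` W"] dim_subset_UNIV[of "T ` W"] linear_subspace_image[OF T W]
    by (metis order_antisym span_eq_iff)
  then obtain L where L: "linear L" "range L \<subseteq> W" "\<And>z. T (L z) = z"
    using linear_exists_right_inverse_on[OF T W] by auto
  have "x \<bullet> g x \<le> L (T x) \<bullet> g (L (T x))" for x
  proof -
    define y where "y = L (T x)"
    define k where "k = x - y"
    have "k \<in> K"
      using L(3) by (simp add: k_def y_def K_def linear_diff[OF T])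
    moreover have "y \<in> W"
      using L(2) y_def by auto
    ultimately have "g k \<bullet> y + k \<bullet> g y = 0"
      using fxy by (simp add: W_def)
    moreover have "k \<bullet> g k \<le> 0"
      using neg[of k] \<open>k \<in> K\<close> by (cases "k = 0") (auto simp: K_def)
    \<comment> \<open>Expansion at \<open>x = k + y\<close>; the cross terms vanish because
      \<open>k\<close> is in \<open>K\<close> and \<open>y\<close> in \<open>W\<close>.\<close>
    moreover have "x \<bullet> g x = k \<bullet> g k + (g k \<bullet> y + k \<bullet> g y) + y \<bullet> g y"
      unfolding k_def linear_diff[OF g] by (simp add: algebra_simps inner_commute)
    ultimately show ?thesis
      by (simp add: y_def)
  qed
  with L that show thesis by blast
qed

lemma quadratic_form_separation:
  fixes T1 :: "'a::euclidean_space \<Rightarrow> 'c::euclidean_space"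
    and T2 :: "'b::euclidean_space \<Rightarrow> 'c"
  assumes T1: "linear T1" "surj T1" and T2: "linear T2" "surj T2"
    and g1: "linear g1" and g2: "linear g2"
    and neg: "\<And>x y. T1 x = T2 y \<Longrightarrow> (x, y) \<noteq> 0 \<Longrightarrow> x \<bullet> g1 x + y \<bullet> g2 y < 0"
  obtains h where "linear h"
    "\<And>x. x \<noteq> 0 \<Longrightarrow> x \<bullet> g1 x < T1 x \<bullet> h (T1 x)"
    "\<And>y. y \<noteq> 0 \<Longrightarrow> y \<bullet> g2 y < - (T2 y \<bullet> h (T2 y))"
proof -
  have neg1: "x \<bullet> g1 x < 0" if "T1 x = 0" "x \<noteq> 0" for x
    using neg[of x 0] that linear_0[OF T2(1)] by (simp add: zero_prod_def)
  have neg2: "y \<bullet> g2 y < 0" if "T2 y = 0" "y \<noteq> 0" for y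
    using neg[of 0 y] that linear_0[OF T1(1)] by (simp add: zero_prod_def)
  obtain L1 where L1: "linear L1" "\<And>z. T1 (L1 z) = z"
    "\<And>x. x \<bullet> g1 x \<le> L1 (T1 x) \<bullet> g1 (L1 (T1 x))"
    using linear_fiberwise_maximizer[OF T1 g1] neg1 by blast
  obtain L2 where L2: "linear L2" "\<And>z. T2 (L2 z) = z"
    "\<And>y. y \<bullet> g2 y \<le> L2 (T2 y) \<bullet> g2 (L2 (T2 y))"
    using linear_fiberwise_maximizer[OF T2 g2] neg2 by blast
  \<comment> \<open>The adjoints turn \<open>L1 z \<bullet> g1 (L1 z)\<close> and
    \<open>L2 z \<bullet> g2 (L2 z)\<close>, the two fibrewise maxima, into forms in
    \<open>z\<close>; \<open>h\<close> represents half their difference.\<close>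
  define h where
    "h z = (1/2) *\<^sub>R (adjoint L1 (g1 (L1 z)) - adjoint L2 (g2 (L2 z)))" for z
  have lin: "linear (\<lambda>z. adjoint L1 (g1 (L1 z)))" "linear (\<lambda>z. adjoint L2 (g2 (L2 z)))"
    using linear_compose[OF L1(1) linear_compose[OF g1 adjoint_linear[OF L1(1)]]]
      linear_compose[OF L2(1) linear_compose[OF g2 adjoint_linear[OF L2(1)]]]
    by (simp_all add: o_def)
  have "linear h"
    unfolding h_def by (rule linear_compose_scale_right[OF linear_compose_sub[OF lin]])
  have h: "z \<bullet> h z = (L1 z \<bullet> g1 (L1 z) - L2 z \<bullet> g2 (L2 z)) / 2" for z
    by (simp add: h_def inner_diff_right adjoint_clauses L1(1) L2(1))
  have sum_neg: "L1 z \<bullet> g1 (L1 z) + L2 z \<bullet> g2 (L2 z) < 0" if "z \<noteq> 0" for z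
  proof (rule neg)
    show "T1 (L1 z) = T2 (L2 z)"
      by (simp add: L1 L2)
    show "(L1 z, L2 z) \<noteq> 0"
      using that L1(2)[of z] linear_0[OF T1(1)] by (auto simp: zero_prod_def)
  qed
  show thesis
  proof
    show "linear h" by fact
    show "x \<bullet> g1 x < T1 x \<bullet> h (T1 x)" if "x \<noteq> 0" for x
    \<comment> \<open>Above \<open>0\<close> the gap between the maxima closes, so strictness must
      come from negativity on the kernel.\<close>
    proof (cases "T1 x = 0")
      case True
      then show ?thesis using neg1 that by simp
    next
      case False
      then show ?thesis using sum_neg[OF False] L1(3)[of x] by (simp add: h field_simps)
    qed
    show "y \<bullet> g2 y < - (T2 y \<bullet> h (T2 y))" if "y \<noteq> 0" for y
    proof (cases "T2 y = 0")
      case True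
      then show ?thesis using neg2 that by simp
    next
      case False
      then show ?thesis using sum_neg[OF False] L2(3)[of y] by (simp add: h field_simps)
    qed
  qed
qed

section \<open>Stacked vectors and symmetric matrices\<close>

lemma inner_stack: "stack x1 x2 \<bullet> stack y1 y2 = x1 \<bullet> y1 + x2 \<bullet> y2"
proof -
  have "sum f UNIV = (\<Sum>a\<in>UNIV. f (Inl a)) + (\<Sum>b\<in>UNIV. f (Inr b))"
    for f :: "'a::finite + 'b::finite \<Rightarrow> real"
    by (subst UNIV_Plus_UNIV[symmetric], subst sum.Plus) auto
  then show ?thesis
    by (simp add: inner_vec_def stack_def)
qed

lemma stack_eq_0_iff: "stack x y = 0 \<longleftrightarrow> x = 0 \<and> y = 0"
  by (auto simp: vec_eq_iff stack_def split: sum.splits)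

lemma transpose_scaleR: "transpose (c *\<^sub>R M) = c *\<^sub>R transpose (M :: real^'n^'m)"
  by (simp add: transpose_def vec_eq_iff)

text \<open>Only the symmetric part of the matrix of \<open>G\<close> contributes to
  \<open>z \<bullet> G z\<close>.\<close>

lemma linear_inner_eq_quad_form:
  fixes G :: "real^'n \<Rightarrow> real^'n"
  assumes "linear G"
  obtains S where "sym_matrix S" "\<And>z. z \<bullet> G z = quad_form S z"
proof
  let ?M = "matrix G"
  let ?S = "(1/2) *\<^sub>R (?M + transpose ?M)"
  have "transpose (?M + transpose ?M) = ?M + transpose ?M"
    by (simp add: transpose_def vec_eq_iff)
  then show "sym_matrix ?S"
    by (simp add: sym_matrix_def transpose_scaleR)
  have "z \<bullet> (z v* ?M) = z \<bullet> G z" for z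
    by (simp add: inner_commute[of z] dot_lmul_matrix matrix_works assms)
  then show "z \<bullet> G z = quad_form ?S z" for z
    by (simp add: quad_form_def scaleR_matrix_vector_assoc[symmetric]
        matrix_vector_mult_add_rdistrib inner_add_right matrix_works assms)
qed

text \<open>The form of \<open>h\<close> pulled back along \<open>J\<close> is that of
  \<open>adjoint J \<circ> h \<circ> J\<close>. This carries forms on pairs over to stacked
  vectors.\<close>

lemma quadratic_functionI:
  fixes h :: "'c::euclidean_space \<Rightarrow> 'c" and J :: "real^('v::finite + 'w::finite) \<Rightarrow> 'c"
  assumes h: "linear h" and J: "linear J"
    and s: "\<And>v w. s v w = J (stack v w) \<bullet> h (J (stack v w))"
  shows "quadratic_function s"
proof -
  have "linear (\<lambda>z. adjoint J (h (J z)))"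
    using linear_compose[OF J linear_compose[OF h adjoint_linear[OF J]]] by (simp add: o_def)
  then obtain S where "sym_matrix S" "\<And>z. z \<bullet> adjoint J (h (J z)) = quad_form S z"
    using linear_inner_eq_quad_form by blast
  then show ?thesis
    unfolding quadratic_function_def by (auto simp: s adjoint_clauses[OF J])
qed

definition unstack :: "real^('a::finite + 'b::finite) \<Rightarrow> (real^'a) \<times> (real^'b)" where
  "unstack z = (\<chi> a. z $ Inl a, \<chi> b. z $ Inr b)"

lemma unstack_stack: "unstack (stack x y) = (x, y)"
  by (simp add: unstack_def stack_def vec_eq_iff)

lemma linear_unstack: "linear unstack"
  by (rule linearI) (simp_all add: unstack_def vec_eq_iff)

lemma quad_form_lyapunov:
  fixes A P :: "real^'n^'n"
  assumes "sym_matrix P"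
  shows "quad_form (transpose A ** P + P ** A) z = 2 * (z \<bullet> (P *v (A *v z)))"
proof -
  have P: "z v* P = P *v z"
    using assms by (metis sym_matrix_def transpose_matrix_vector)
  have "z \<bullet> ((P *v z) v* A) = (P *v z) \<bullet> (A *v z)"
    by (simp only: inner_commute[of z] dot_lmul_matrix)
  also have "\<dots> = z \<bullet> (P *v (A *v z))"
    by (simp only: P[symmetric] dot_lmul_matrix)
  finally show ?thesis
    by (simp add: quad_form_def matrix_vector_mult_add_rdistrib inner_add_right
        matrix_vector_mul_assoc[symmetric])
qed

lemma sym_matrix_block_diagonal:
  assumes "sym_matrix P1" "sym_matrix P2"
  shows "sym_matrix (block_matrix P1 0 0 P2)"
  using assms
  by (simp add: sym_matrix_def transpose_def vec_eq_iff block_matrix_def stack_def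
      split: sum.split)

section \<open>Signals of the interconnection\<close>

text \<open>On interconnection signals the closed-loop matrix yields both state derivatives, and the
  block diagonal matrix splits the form into one term per system.\<close>

lemma additive_lyapunov_derivative_neg:
  assumes wp: "well_posed C1 D1 C2 D2"
    and P: "sym_matrix P1" "sym_matrix P2"
    and lyap: "sym_neg_def (transpose (closed_loop A1 B1 C1 D1 A2 B2 C2 D2) ** block_matrix P1 0 0 P2
      + block_matrix P1 0 0 P2 ** closed_loop A1 B1 C1 D1 A2 B2 C2 D2)"
    and ic: "interconnection C1 D1 C2 D2 x1 x2 v1 v2"
    and nz: "(x1, x2) \<noteq> 0"
  shows "x1 \<bullet> (P1 *v (A1 *v x1 + B1 *v v1)) + x2 \<bullet> (P2 *v (A2 *v x2 + B2 *v v2)) < 0"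
proof -
  have "stack x1 x2 \<noteq> 0"
    using nz by (auto simp: stack_eq_0_iff zero_prod_def)
  then show ?thesis
    using lyap unfolding sym_neg_def_def quad_form_lyapunov[OF sym_matrix_block_diagonal[OF P]]
    by (auto simp: closed_loop_eq[OF wp ic] block_matrix_vector_mult inner_stack
        dest!: spec[of _ "stack x1 x2"])
qed

text \<open>The input is prescribed freely; full row rank then provides a state with
  \<open>C *v x = w - D *v v\<close>.\<close>

lemma surj_output_map:
  fixes C :: "real^'n^'w" and D :: "real^'v^'w"
  assumes "rank C = CARD('w)"
  shows "surj (\<lambda>(x, v). (v, C *v x + D *v v))"
proof -
  have "surj ((*v) C)"
    using assms by (simp add: full_rank_surjective[symmetric])
  then obtain R where R: "\<And>y. C *v R y = y"
    by (metis surj_def)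
  show ?thesis
    by (rule surjI[of _ "\<lambda>(v, w). (R (w - D *v v), v)"]) (auto simp: R)
qed

lemma linear_output_map:
  fixes C :: "real^'n^'w" and D :: "real^'v^'w"
  shows "linear (\<lambda>(x, v). (v, C *v x + D *v v))"
  by (rule linearI)
    (auto simp: matrix_vector_right_distrib matrix_vector_mult_scaleR scaleR_right_distrib)

text \<open>The zero component makes the inner product with \<open>(x, v)\<close> equal to the
  derivative of the storage function.\<close>

lemma linear_storage_derivative:
  fixes A P :: "real^'n^'n" and B :: "real^'v^'n"
  shows "linear (\<lambda>(x, v). (2 *\<^sub>R (P *v (A *v x + B *v v)), 0 :: real^'v))"
  by (rule linearI)
    (auto simp: matrix_vector_right_distrib matrix_vector_mult_scaleR scaleR_right_distrib mult.commute)

theorem corollary3p2: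
  fixes A1 :: "real^'n1^'n1" and B1 :: "real^'m1^'n1"
    and C1 :: "real^'n1^'m2" and D1 :: "real^'m1^'m2"
    and A2 :: "real^'n2^'n2" and B2 :: "real^'m2^'n2"
    and C2 :: "real^'n2^'m1" and D2 :: "real^'m2^'m1"
    and V :: "real^'n1 \<Rightarrow> real^'n2 \<Rightarrow> real"
    and V1 :: "real^'n1 \<Rightarrow> real" and V2 :: "real^'n2 \<Rightarrow> real"
  assumes "rank C1 = CARD('m2)" and "rank C2 = CARD('m1)"
    and "well_posed C1 D1 C2 D2"
    and "asymptotically_stable (closed_loop A1 B1 C1 D1 A2 B2 C2 D2)"
    and "additive_quadratic_lyapunov (closed_loop A1 B1 C1 D1 A2 B2 C2 D2) V V1 V2"
  shows "\<exists>(s1 :: real^'m1 \<Rightarrow> real^'m2 \<Rightarrow> real) (s2 :: real^'m2 \<Rightarrow> real^'m1 \<Rightarrow> real).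
      quadratic_function s1 \<and> quadratic_function s2 \<and>
      (\<forall>v1 w1 v2 w2. v1 = w2 \<and> v2 = w1 \<longrightarrow> s1 v1 w1 + s2 v2 w2 = 0) \<and>
      strictly_dissipative A1 B1 C1 D1 s1 V1 \<and>
      strictly_dissipative A2 B2 C2 D2 s2 V2"
proof -
  obtain P1 P2 where P: "sym_matrix P1" "sym_matrix P2"
    and V: "V1 = quad_form P1" "V2 = quad_form P2"
    and lyap: "sym_neg_def (transpose (closed_loop A1 B1 C1 D1 A2 B2 C2 D2) ** block_matrix P1 0 0 P2
      + block_matrix P1 0 0 P2 ** closed_loop A1 B1 C1 D1 A2 B2 C2 D2)"
    using assms(5) by (auto simp: additive_quadratic_lyapunov_def sym_pos_def_def Let_def)
  define T1 where "T1 = (\<lambda>(x, v). (v, C1 *v x + D1 *v v))"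
  \<comment> \<open>The swap turns input and output of the second system into
    \<open>(w2, v2)\<close>, to be matched with \<open>(v1, w1)\<close>.\<close>
  define T2 where "T2 = prod.swap \<circ> (\<lambda>(x, v). (v, C2 *v x + D2 *v v))"
  define g1 :: "(real^'n1) \<times> (real^'m1) \<Rightarrow> (real^'n1) \<times> (real^'m1)"
    where "g1 = (\<lambda>(x, v). (2 *\<^sub>R (P1 *v (A1 *v x + B1 *v v)), 0))"
  define g2 :: "(real^'n2) \<times> (real^'m2) \<Rightarrow> (real^'n2) \<times> (real^'m2)"
    where "g2 = (\<lambda>(x, v). (2 *\<^sub>R (P2 *v (A2 *v x + B2 *v v)), 0))"
  have swap: "linear (prod.swap :: (real^'m2) \<times> (real^'m1) \<Rightarrow> _)"
    by (rule linearI) auto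
  have T1: "linear T1" "surj T1"
    unfolding T1_def by (rule linear_output_map, rule surj_output_map[OF assms(1)])
  have T2: "linear T2" "surj T2"
    unfolding T2_def
    by (rule linear_compose[OF linear_output_map swap],
        rule comp_surj[OF surj_output_map[OF assms(2)] surj_swap])
  have g: "linear g1" "linear g2"
    unfolding g1_def g2_def by (rule linear_storage_derivative)+
  have neg: "\<xi>1 \<bullet> g1 \<xi>1 + \<xi>2 \<bullet> g2 \<xi>2 < 0" if eq: "T1 \<xi>1 = T2 \<xi>2" and nz: "(\<xi>1, \<xi>2) \<noteq> 0" for \<xi>1 \<xi>2
  proof -
    obtain x1 v1 x2 v2 where \<xi>: "\<xi>1 = (x1, v1)" "\<xi>2 = (x2, v2)"
      by fastforce
    have "(v1, C1 *v x1 + D1 *v v1) = (C2 *v x2 + D2 *v v2, v2)"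
      using eq by (simp only: T1_def T2_def \<xi> o_def prod.case prod.swap_def fst_conv snd_conv)
    then have ic: "interconnection C1 D1 C2 D2 x1 x2 v1 v2"
      unfolding interconnection_def by (metis prod.inject)
    \<comment> \<open>The Lyapunov inequality needs a nonzero state: by well-posedness, zero states
      would force zero signals.\<close>
    have "(x1, x2) \<noteq> 0"
    proof
      assume "(x1, x2) = 0"
      moreover have "interconnection C1 D1 C2 D2 0 0 0 0"
        by (simp add: interconnection_def)
      ultimately have "(v1, v2) = (0, 0)"
        using assms(3) ic unfolding well_posed_def by (metis fst_conv snd_conv zero_prod_def)
      then show False
        using nz \<open>(x1, x2) = 0\<close> by (simp add: \<xi> zero_prod_def)
    qed
    from additive_lyapunov_derivative_neg[OF assms(3) P lyap ic this] show ?thesis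
      by (simp add: g1_def g2_def \<xi>)
  qed
  obtain h where h: "linear h"
    "\<And>\<xi>. \<xi> \<noteq> 0 \<Longrightarrow> \<xi> \<bullet> g1 \<xi> < T1 \<xi> \<bullet> h (T1 \<xi>)"
    "\<And>\<xi>. \<xi> \<noteq> 0 \<Longrightarrow> \<xi> \<bullet> g2 \<xi> < - (T2 \<xi> \<bullet> h (T2 \<xi>))"
    using quadratic_form_separation[OF T1 T2 g neg] by blast
  define s1 where "s1 v w = (v, w) \<bullet> h (v, w)" for v w
  \<comment> \<open>The arguments are swapped as in \<open>T2\<close>, so that \<open>s1\<close> and
    \<open>s2\<close> cancel on matched signals.\<close>
  define s2 where "s2 v w = - ((w, v) \<bullet> h (w, v))" for v w
  have "quadratic_function s1"
    using h(1) linear_unstack by (rule quadratic_functionI) (simp add: s1_def unstack_stack)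
  moreover have "quadratic_function s2"
    using linear_compose_neg[OF h(1)] linear_compose[OF linear_unstack swap]
    by (rule quadratic_functionI) (simp add: s2_def unstack_stack)
  moreover have "strictly_dissipative A1 B1 C1 D1 s1 V1"
    unfolding strictly_dissipative_def
    using P(1) V(1) h(2) by (force simp: g1_def T1_def s1_def zero_prod_def)
  moreover have "strictly_dissipative A2 B2 C2 D2 s2 V2"
    unfolding strictly_dissipative_def
    using P(2) V(2) h(3) by (force simp: g2_def T2_def s2_def zero_prod_def)
  moreover have "\<forall>v1 w1 v2 w2. v1 = w2 \<and> v2 = w1 \<longrightarrow> s1 v1 w1 + s2 v2 w2 = 0"
    by (simp add: s1_def s2_def)
  ultimately show ?thesis
    by blast
qed

end
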